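(* Let $\mathcal{R}$ be a symmetric association scheme. If all pairs of non-trivial relations fuse, then $\mathcal{R}$ is amorphic.
   Context: A symmetric $d$-class association scheme on a finite set $X$ is a set $\mathcal{R}=\{A_0,\dots,A_d\}$ of $X\times X$ $01$-matrices with $A_0=I$, $\sum_iA_i=J$, $A_i^\top=A_i$, $A_iA_j=\sum_h p_{ij}^hA_h$; $A_1,\dots,A_d$ are the non-trivial relations. A pair $\{A_i,A_j\}$ ($i\neq j$, $i,j\ge 1$) fuses if replacing $A_i,A_j$ by $A_i+A_j$ (keeping the others) yields an association scheme. $\mathcal{R}$ is amorphic if for every partition of $\{0,\dots,d\}$ having $\{0\}$ as a part, the sums of the $A_l$ over the parts form an association scheme. *)

theory Defs
  imports "HOL-Analysis.Analysis" "HOL-Library.Disjoint_Sets"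
begin

text \<open>
  The vertex set is a finite type, and a scheme is the set of its adjacency matrices; the
  trivial relation \<open>A\<^sub>0\<close> is the identity matrix \<open>mat 1\<close>. A partition of the index set
  \<open>{0,\<dots>,d}\<close> with part \<open>{0}\<close> is thus a partition of the scheme with part \<open>{mat 1}\<close>.
  The zero matrix is not excluded as a relation (there is at most one such). The
  coefficients at the nonzero relations are unique and automatically nonnegative integers,
  so nothing is gained by requiring \<open>p\<close> to be integer valued.
\<close>

definition all_ones :: "real ^ 'x ^ 'x" where
  "all_ones = (\<chi> x y. 1)"

definition symmetric_scheme :: "(real ^ 'x ^ 'x::finite) set \<Rightarrow> bool" where
  "symmetric_scheme R \<longleftrightarrow>
     (\<forall>A\<in>R. \<forall>x y. A $ x $ y \<in> {0, 1}) \<and>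
     mat 1 \<in> R \<and>
     (\<Sum>A\<in>R. A) = all_ones \<and>
     (\<forall>A\<in>R. transpose A = A) \<and>
     (\<exists>p. \<forall>A\<in>R. \<forall>B\<in>R. A ** B = (\<Sum>C\<in>R. p A B C *\<^sub>R C))"

definition nontrivial_relations :: "(real ^ 'x ^ 'x::finite) set \<Rightarrow> (real ^ 'x ^ 'x) set" where
  "nontrivial_relations R = R - {mat 1}"

definition pair_fuses ::
    "(real ^ 'x ^ 'x::finite) set \<Rightarrow> real ^ 'x ^ 'x \<Rightarrow> real ^ 'x ^ 'x \<Rightarrow> bool" where
  "pair_fuses R A B \<longleftrightarrow> symmetric_scheme (insert (A + B) (R - {A, B}))"

definition amorphic :: "(real ^ 'x ^ 'x::finite) set \<Rightarrow> bool" where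
  "amorphic R \<longleftrightarrow>
     (\<forall>P. partition_on R P \<and> {mat 1} \<in> P \<longrightarrow> symmetric_scheme ((\<lambda>S. \<Sum>A\<in>S. A) ` P))"

end

theory Submission
  imports Defs
begin

text \<open>
  The span of a scheme is closed under multiplication, and it consists of the matrices that are
  constant on each relation. Such a matrix is constant on the parts of a partition \<open>P\<close> iff it is
  constant on \<open>C + D\<close> for any two relations \<open>C\<close>, \<open>D\<close> in a common part. So the span of the fusion
  by \<open>P\<close> is the intersection of the span of the scheme with those of pairwise fusions, and an
  intersection of subalgebras is a subalgebra.
\<close>

text \<open>This is the part of \<open>symmetric_scheme\<close> that concerns single entries. It is
  kept apart because it has to be known for the fused matrices before they are known to form a
  scheme.\<close>

definition tiling :: "(real ^ 'x ^ 'x::finite) set \<Rightarrow> bool" where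
  "tiling R \<longleftrightarrow> (\<forall>A\<in>R. \<forall>x y. A $ x $ y \<in> {0, 1}) \<and> (\<Sum>A\<in>R. A) = all_ones"

lemma tiling_if_symmetric_scheme: "symmetric_scheme R \<Longrightarrow> tiling R"
  by (auto simp: symmetric_scheme_def tiling_def)

lemma tiling_finite:
  assumes "tiling R"
  shows "finite R"
proof (rule ccontr)
  assume "infinite R"
  \<comment> \<open>A sum over an infinite set is 0 by convention.\<close>
  with assms have "(all_ones :: real^'a^'a) = 0"
    by (simp add: tiling_def)
  then have "(all_ones :: real^'a^'a) $ undefined $ undefined = 0"
    by simp
  then show False
    by (simp add: all_ones_def)
qed

text \<open>With entries in {0, 1}, the entry of the total sum at a position counts the relations
  having a 1 there, and that entry is 1.\<close>

lemma tiling_ex1: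
  assumes "tiling R"
  shows "\<exists>!E. E \<in> R \<and> E $ x $ y = 1"
proof -
  have fin: "finite R" using assms by (rule tiling_finite)
  have "real (card {E \<in> R. E $ x $ y = 1}) = (\<Sum>E\<in>R. of_bool (E $ x $ y = 1))"
    using fin by (simp add: of_bool_def sum.If_cases Int_def)
  also have "\<dots> = (\<Sum>E\<in>R. E $ x $ y)"
    using assms by (intro sum.cong) (fastforce simp: tiling_def)+
  also have "\<dots> = (\<Sum>E\<in>R. E) $ x $ y"
    by simp
  also have "\<dots> = 1"
    using assms by (simp add: tiling_def all_ones_def)
  finally have "card {E \<in> R. E $ x $ y = 1} = 1" by simp
  then obtain E where "{E \<in> R. E $ x $ y = 1} = {E}"
    by (rule card_1_singletonE)
  then have "F \<in> R \<and> F $ x $ y = 1 \<longleftrightarrow> F = E" for F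
    by (simp only: set_eq_iff mem_Collect_eq singleton_iff)
  then show ?thesis
    by simp
qed

lemma tiling_entry:
  assumes "tiling R" "E \<in> R" "E $ x $ y = 1" "A \<in> R"
  shows "A $ x $ y = of_bool (A = E)"
  using assms tiling_ex1[OF assms(1), of x y] unfolding tiling_def by fastforce

lemma tiling_sum_entry:
  assumes "tiling R" "E \<in> R" "E $ x $ y = 1" "S \<subseteq> R"
  shows "(\<Sum>A\<in>S. A) $ x $ y = of_bool (E \<in> S)"
proof -
  have fin: "finite S" using assms tiling_finite finite_subset by blast
  have "(\<Sum>A\<in>S. A) $ x $ y = (\<Sum>A\<in>S. of_bool (A = E))"
    unfolding sum_component
    using assms(4) tiling_entry[OF assms(1-3)] by (intro sum.cong) auto
  then show ?thesis
    using fin by (simp add: of_bool_def)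
qed

text \<open>On the positions of \<open>E\<close>, the generator \<open>E\<close> is constantly 1 and
  every other generator constantly 0. Constancy passes to linear combinations.\<close>

lemma span_const_on_tile:
  assumes "tiling R" "M \<in> span R" "E \<in> R" "E $ x $ y = 1" "E $ x' $ y' = 1"
  shows "M $ x $ y = M $ x' $ y'"
  using assms(2)
proof (induction rule: span_induct_alt)
  case (step c A N)
  then show ?case
    using tiling_entry[OF assms(1,3,4)] tiling_entry[OF assms(1,3,5)] by simp
qed simp

text \<open>A converse of \<open>span_const_on_tile\<close>: the common value on a relation serves
  as its coefficient. Explicit coefficients are the form that \<open>symmetric_scheme\<close> asks
  for.\<close>

lemma const_on_tiles_eq_sum:
  assumes "tiling R"
    and const: "\<And>E x y x' y'. E \<in> R \<Longrightarrow> E $ x $ y = 1 \<Longrightarrow> E $ x' $ y' = 1 \<Longrightarrow> M $ x $ y = M $ x' $ y'"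
  shows "\<exists>p. M = (\<Sum>C\<in>R. p C *\<^sub>R C)"
proof -
  \<comment> \<open>If \<open>E\<close> is the zero matrix, the choice is arbitrary. This is
    harmless, since such an \<open>E\<close> contributes nothing to the sum.\<close>
  define p where "p E = (SOME c. \<exists>x y. E $ x $ y = 1 \<and> M $ x $ y = c)" for E :: "real ^ 'a ^ 'a"
  have p: "M $ x $ y = p E" if "E \<in> R" "E $ x $ y = 1" for E x y
  proof -
    have "\<exists>x' y'. E $ x' $ y' = 1 \<and> M $ x' $ y' = p E"
      unfolding p_def by (rule someI[of _ "M $ x $ y"]) (use that in blast)
    then obtain x' y' where xy': "E $ x' $ y' = 1" "M $ x' $ y' = p E"
      by (elim exE conjE)
    show ?thesis
      unfolding xy'(2)[symmetric] by (rule const[OF that xy'(1)])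
  qed
  have "M $ x $ y = (\<Sum>C\<in>R. p C *\<^sub>R C) $ x $ y" for x y
  proof -
    obtain E where E: "E \<in> R" "E $ x $ y = 1"
      using tiling_ex1[OF assms(1)] by blast
    have "(\<Sum>C\<in>R. p C *\<^sub>R C) $ x $ y = (\<Sum>C\<in>R. if C = E then p C else 0)"
      unfolding sum_component
      using tiling_entry[OF assms(1) E] by (intro sum.cong) auto
    then show ?thesis
      using E p[OF E] tiling_finite[OF assms(1)] by simp
  qed
  then show ?thesis
    by (auto simp: vec_eq_iff)
qed

lemma matrix_add_mult_distrib:
  fixes A B :: "'a::semiring_1 ^ 'n ^ 'm"
  shows "(A + B) ** C = A ** C + B ** C"
  by (simp add: matrix_matrix_mult_def vec_eq_iff distrib_right sum.distrib)

text \<open>Products of two relations lie in the span by the scheme axiom. Bilinearity extends this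
  first to the right factor, then to the left one.\<close>

lemma span_matrix_mult:
  fixes R :: "(real ^ 'x ^ 'x::finite) set"
  assumes "symmetric_scheme R" "M \<in> span R" "N \<in> span R"
  shows "M ** N \<in> span R"
proof -
  have base: "A ** B \<in> span R" if "A \<in> R" "B \<in> R" for A B
  proof -
    obtain p where "\<forall>A\<in>R. \<forall>B\<in>R. A ** B = (\<Sum>C\<in>R. p A B C *\<^sub>R C)"
      using assms(1) unfolding symmetric_scheme_def by (elim conjE exE)
    with that have "A ** B = (\<Sum>C\<in>R. p A B C *\<^sub>R C)"
      by blast
    then show ?thesis
      by (simp add: span_sum span_scale span_base)
  qed
  have right: "A ** N \<in> span R" if "A \<in> R" for A
    using assms(3)
    by (induction rule: span_induct_alt)
      (simp_all add: matrix_add_ldistrib matrix_scalar_ac span_add span_scale span_zero base that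
        flip: scalar_matrix_assoc)
  show ?thesis
    using assms(2)
    by (induction rule: span_induct_alt)
      (simp_all add: matrix_add_mult_distrib span_add span_scale span_zero right
        flip: scalar_matrix_assoc)
qed

text \<open>A set that does not separate \<open>C\<close> from \<open>D\<close> either contains
  both, and then \<open>C + D\<close> splits off from its sum, or avoids both, and then all its
  members survive in the fusion.\<close>

lemma sum_mem_span_fusion:
  assumes "finite S" "S \<subseteq> R" "C \<noteq> D" "C \<in> S \<longleftrightarrow> D \<in> S"
  shows "(\<Sum>A\<in>S. A) \<in> span (insert (C + D) (R - {C, D}))"
proof (cases "C \<in> S")
  case True
  with assms have D: "D \<in> S - {C}" and C: "C \<in> S" by auto
  have "(\<Sum>A\<in>S. A) = (C + D) + (\<Sum>A\<in>S - {C} - {D}. A)"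
    using sum.remove[OF assms(1) C, of id] sum.remove[OF _ D, of id] assms(1) by (simp add: add.assoc)
  also have "\<dots> \<in> span (insert (C + D) (R - {C, D}))"
    using assms by (intro span_add span_sum span_base) auto
  finally show ?thesis .
next
  case False
  with assms show ?thesis
    by (intro span_sum span_base) auto
qed

lemma tiling_fusion:
  fixes R :: "(real ^ 'x ^ 'x::finite) set"
  assumes R: "tiling R" and P: "partition_on R P"
  shows "tiling ((\<lambda>S. \<Sum>A\<in>S. A) ` P)"
  unfolding tiling_def
proof
  have sub: "S \<subseteq> R" if "S \<in> P" for S
    using P that partition_onD1 by blast
  have entry: "(\<Sum>A\<in>S. A) $ x $ y \<in> {0, 1}" if "S \<in> P" for S x y
    using tiling_ex1[OF R, of x y] tiling_sum_entry[OF R _ _ sub[OF that], of _ x y] by fastforce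
  then show "\<forall>A\<in>(\<lambda>S. \<Sum>A\<in>S. A) ` P. \<forall>x y. A $ x $ y \<in> {0, 1}"
    by blast
  have fin: "finite R" using R by (rule tiling_finite)
  then have finP: "finite P" using P by (rule finite_elements)
  \<comment> \<open>Passing to the image merges parts with equal sums. Disjoint parts with equal
    sums cover no position at all, so merging them leaves the total unchanged.\<close>
  have zero: "(\<Sum>A\<in>S. A) = 0"
    if "S \<in> P" "T \<in> P" "S \<noteq> T" and eq: "(\<Sum>A\<in>S. A) = (\<Sum>A\<in>T. A)" for S T
  proof -
    have "(\<Sum>A\<in>S. A) $ x $ y = 0" for x y
    proof -
      obtain E where E: "E \<in> R" "E $ x $ y = 1"
        using tiling_ex1[OF R] by blast
      have "of_bool (E \<in> S) = (of_bool (E \<in> T) :: real)"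
        using tiling_sum_entry[OF R E sub] that by metis
      moreover have "S \<inter> T = {}"
        using that P partition_onD2 disjointD by blast
      ultimately have "E \<notin> S"
        by (auto simp: of_bool_def split: if_splits)
      then show ?thesis
        unfolding tiling_sum_entry[OF R E sub[OF \<open>S \<in> P\<close>]] by simp
    qed
    then show ?thesis
      by (simp only: vec_eq_iff zero_index) simp
  qed
  have "(\<Sum>B\<in>(\<lambda>S. \<Sum>A\<in>S. A) ` P. B) = (\<Sum>S\<in>P. \<Sum>A\<in>S. A)"
    by (subst sum.reindex_nontrivial[OF finP]) (use zero in auto)
  also have "\<dots> = (\<Sum>A\<in>\<Union>P. A)"
    using sub finite_subset[OF _ fin] partition_onD2[OF P]
    by (subst sum.Union_disjoint) (auto simp: disjoint_def)
  also have "\<dots> = all_ones"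
    using R P by (simp add: tiling_def flip: partition_onD1)
  finally show "(\<Sum>B\<in>(\<lambda>S. \<Sum>A\<in>S. A) ` P. B) = all_ones" .
qed

theorem theorem3p2:
  fixes R :: "(real ^ 'x ^ 'x::finite) set"
  assumes "symmetric_scheme R"
    and "\<And>A B. A \<in> nontrivial_relations R \<Longrightarrow> B \<in> nontrivial_relations R \<Longrightarrow> A \<noteq> B \<Longrightarrow>
      pair_fuses R A B"
  shows "amorphic R"
  unfolding amorphic_def
proof (intro allI impI, elim conjE)
  fix P assume P: "partition_on R P" and one: "{mat 1} \<in> P"
  let ?Q = "(\<lambda>S. \<Sum>A\<in>S. A) ` P"
  have R: "tiling R" using assms(1) by (rule tiling_if_symmetric_scheme)
  have Q: "tiling ?Q" using R P by (rule tiling_fusion)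
  have sub: "S \<subseteq> R" if "S \<in> P" for S
    using P that partition_onD1 by blast
  have fin: "finite S" if "S \<in> P" for S
    using sub[OF that] tiling_finite[OF R] finite_subset by blast
  have same_part: "S = T" if "S \<in> P" "T \<in> P" "C \<in> S" "C \<in> T" for S T C
    using that P partition_onD2 disjointD by blast
  have prod_const: "((\<Sum>A\<in>S. A) ** (\<Sum>A\<in>T. A)) $ x $ y = ((\<Sum>A\<in>S. A) ** (\<Sum>A\<in>T. A)) $ x' $ y'"
    if "S \<in> P" "T \<in> P" "U \<in> P" and U: "(\<Sum>A\<in>U. A) $ x $ y = 1" "(\<Sum>A\<in>U. A) $ x' $ y' = 1"
    for S T U x y x' y'
  proof -
    \<comment> \<open>Two positions in the same fused relation may come from different relations
      \<open>C\<close> and \<open>D\<close> of \<open>R\<close>. If they agree, the span of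
      \<open>R\<close> suffices; otherwise the fusion of \<open>C\<close> and \<open>D\<close> is
      used.\<close>
    obtain C where C: "C \<in> R" "C $ x $ y = 1"
      using tiling_ex1[OF R] by blast
    obtain D where D: "D \<in> R" "D $ x' $ y' = 1"
      using tiling_ex1[OF R] by blast
    have CU: "C \<in> U" and DU: "D \<in> U"
      using tiling_sum_entry[OF R C sub[OF \<open>U \<in> P\<close>]] tiling_sum_entry[OF R D sub[OF \<open>U \<in> P\<close>]] U
      by (auto simp: of_bool_def split: if_splits)
    show ?thesis
    proof (cases "C = D")
      case True
      have "(\<Sum>A\<in>S. A) ** (\<Sum>A\<in>T. A) \<in> span R"
        using sub that by (intro span_matrix_mult[OF assms(1)] span_sum span_base) auto
      then show ?thesis
        using span_const_on_tile[OF R _ C] D True by blast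
    next
      case False
      let ?F = "insert (C + D) (R - {C, D})"
      \<comment> \<open>The part \<open>U\<close> has two distinct members, so it is not
        \<open>{mat 1}\<close> and hence is disjoint from it.\<close>
      have "C \<noteq> mat 1" "D \<noteq> mat 1"
        using same_part[OF one \<open>U \<in> P\<close>] CU DU False by auto
      then have F: "symmetric_scheme ?F"
        using assms(2)[of C D] C D False by (simp add: nontrivial_relations_def pair_fuses_def)
      \<comment> \<open>A part containing one of \<open>C\<close>, \<open>D\<close> must be
        \<open>U\<close>, which contains both, so no part separates them.\<close>
      have "(\<Sum>A\<in>V. A) \<in> span ?F" if "V \<in> P" for V
        using same_part[OF that \<open>U \<in> P\<close>] CU DU False
        by (intro sum_mem_span_fusion[OF fin[OF that] sub[OF that]]) auto
      then have "(\<Sum>A\<in>S. A) ** (\<Sum>A\<in>T. A) \<in> span ?F"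
        using that by (intro span_matrix_mult[OF F]) auto
      \<comment> \<open>Both positions lie in the single relation \<open>C + D\<close> of
        \<open>?F\<close>, on which every matrix in the span of \<open>?F\<close> is
        constant.\<close>
      moreover have "(C + D) $ x $ y = 1" "(C + D) $ x' $ y' = 1"
        using tiling_entry[OF R C] tiling_entry[OF R D] C D False by auto
      ultimately show ?thesis
        using span_const_on_tile[OF tiling_if_symmetric_scheme[OF F]] by blast
    qed
  qed
  have "\<exists>p. A ** B = (\<Sum>C\<in>?Q. p C *\<^sub>R C)" if AB_in: "A \<in> ?Q" "B \<in> ?Q" for A B
  proof (rule const_on_tiles_eq_sum[OF Q])
    obtain S T where "S \<in> P" "T \<in> P" and AB: "A = (\<Sum>A\<in>S. A)" "B = (\<Sum>A\<in>T. A)"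
      using AB_in by blast
    then show "(A ** B) $ x $ y = (A ** B) $ x' $ y'"
      if "E \<in> ?Q" "E $ x $ y = 1" "E $ x' $ y' = 1" for E x y x' y'
      using that prod_const unfolding AB by blast
  qed
  then have "\<forall>A B. \<exists>p. A \<in> ?Q \<longrightarrow> B \<in> ?Q \<longrightarrow> A ** B = (\<Sum>C\<in>?Q. p C *\<^sub>R C)"
    by blast
  then have "\<exists>p. \<forall>A\<in>?Q. \<forall>B\<in>?Q. A ** B = (\<Sum>C\<in>?Q. p A B C *\<^sub>R C)"
    unfolding choice_iff by blast
  moreover have "mat 1 \<in> ?Q"
    using one by force
  moreover have "\<forall>B\<in>?Q. transpose B = B"
  proof (intro ballI, elim imageE)
    fix B S assume B: "B = (\<Sum>A\<in>S. A)" and "S \<in> P"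
    have "transpose A = A" if "A \<in> S" for A
      using assms(1) sub[OF \<open>S \<in> P\<close>] that by (auto simp only: symmetric_scheme_def)
    then have "(\<Sum>A\<in>S. transpose A) = (\<Sum>A\<in>S. A)"
      by (rule sum.cong[OF refl])
    then show "transpose B = B"
      by (simp add: B transpose_def vec_eq_iff)
  qed
  ultimately show "symmetric_scheme ?Q"
    using Q unfolding symmetric_scheme_def tiling_def by - (elim conjE, intro conjI)
qed

end
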